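(* For each natural number $M$ let $x_M$ be the real number determined by $\operatorname{Li}(x_M)=\pi^*(x_M,M)$, and define $\alpha_{L,M}:=x_{M+1}/x_M$. Then, as $M\to\infty$, \[ \log\alpha_{L,M}=\log\alpha_{L,M+1}+o(\log\alpha_{L,M+1}) \] and \[ \lim_{M\to\infty}\alpha_{L,M}=\alpha_{L,\infty}=e, \] where $\alpha_{L,\infty}$ is a constant equal to $e$.
   Context: $\operatorname{Li}(x):=\int_{2}^{x}\frac{dt}{\log t}$ with $\log$ the natural logarithm. For real $x>1$ and a natural number $M\ge 0$, $\pi^*(x,M):=\frac{x}{\log x}\sum_{n=0}^{M}\frac{n!}{\log^n x}$, where $\log^n x=(\log x)^n$. The number $x_M$ is the real number $x_M>2$ satisfying $\operatorname{Li}(x_M)=\pi^*(x_M,M)$. *)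

theory Defs
  imports "HOL-Analysis.Analysis" "HOL-Library.Landau_Symbols"
begin

text \<open>Only the range \<open>x \<ge> 2\<close> matters below; for \<open>x < 2\<close> the set integral is \<open>0\<close> rather than the
  signed integral.\<close>
definition Li :: "real \<Rightarrow> real" where
  "Li x = integral {2..x} (\<lambda>t. 1 / ln t)"

definition pi_star :: "real \<Rightarrow> nat \<Rightarrow> real" where
  "pi_star x M = x / ln x * (\<Sum>n=0..M. fact n / ln x ^ n)"

text \<open>The description is proper by \<open>ex1_x_L\<close> below.\<close>
definition x_L :: "nat \<Rightarrow> real" where
  "x_L M = (THE x. x > 2 \<and> Li x = pi_star x M)"

definition alpha_L :: "nat \<Rightarrow> real" where
  "alpha_L M = x_L (M + 1) / x_L M"

lemma Li_has_derivative:
  assumes "x \<ge> 2"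
  shows "(Li has_real_derivative 1 / ln x) (at x within {2..})"
proof -
  have "continuous_on {2..x+1} (\<lambda>t::real. 1 / ln t)"
    by (intro continuous_intros) auto
  hence "((\<lambda>u. integral {2..u} (\<lambda>t. 1 / ln t)) has_real_derivative 1 / ln x) (at x within {2..x+1})"
    by (rule integral_has_real_derivative) (use assms in auto)
  moreover have "at x within {2..x+1} = at x within {2..}"
    by (rule at_within_nhd[where S = "{x-1<..<x+1}"]) auto
  ultimately show ?thesis by (simp add: Li_def[abs_def])
qed

lemma pi_star_has_derivative:
  assumes "x > 1"
  shows "((\<lambda>x. pi_star x M) has_real_derivative 1 / ln x - fact (M+1) / ln x ^ (M+2)) (at x)"
proof (induction M)
  case 0
  show ?case unfolding pi_star_def using assms
    by (auto intro!: derivative_eq_intros simp: field_simps power2_eq_square)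
next
  case (Suc M)
  have eq: "pi_star x (Suc M) = pi_star x M + x * fact (M+1) / ln x ^ (M+2)" for x
    by (simp add: pi_star_def distrib_left del: fact_Suc)
  have "((\<lambda>x. x * fact (M+1) / ln x ^ (M+2)) has_real_derivative
          fact (M+1) / ln x ^ (M+2) - fact (M+2) / ln x ^ (M+3)) (at x)"
  proof -
    have pw: "((\<lambda>x. ln x ^ (M+2)) has_real_derivative (M+2) * ln x ^ (M+1) / x) (at x)"
      using DERIV_power[OF DERIV_ln_divide[of x], of "M+2"] assms by (simp add: field_simps)
    have "((\<lambda>x. x * fact (M+1) / ln x ^ (M+2)) has_real_derivative
        (fact (M+1) * ln x ^ (M+2) - x * fact (M+1) * ((M+2) * ln x ^ (M+1) / x)) /
        (ln x ^ (M+2) * ln x ^ (M+2))) (at x)"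
      by (rule DERIV_divide[OF _ pw]) (use assms in \<open>auto intro!: derivative_eq_intros\<close>)
    also have "(fact (M+1) * ln x ^ (M+2) - x * fact (M+1) * ((M+2) * ln x ^ (M+1) / x)) /
        (ln x ^ (M+2) * ln x ^ (M+2)) = fact (M+1) / ln x ^ (M+2) - fact (M+2) / ln x ^ (M+3)"
      using assms by (simp add: field_simps eval_nat_numeral)
    finally show ?thesis .
  qed
  from DERIV_add[OF Suc.IH this] show ?case
    by (simp add: eq eval_nat_numeral del: fact_Suc)
qed

lemma ex1_x_L: "\<exists>!x. x > 2 \<and> Li x = pi_star x M"
proof -
  define D where "D = (\<lambda>x. Li x - pi_star x M)"
  define d where "d = (\<lambda>x::real. fact (M+1) / ln x ^ (M+2) :: real)"
  have D: "(D has_real_derivative d x) (at x within {2..})" if "x \<ge> 2" for x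
    using DERIV_diff[OF Li_has_derivative[OF that] has_field_derivative_at_within[OF pi_star_has_derivative[of x M]]] that
    by (simp add: D_def d_def)
  have d_pos: "d x > 0" if "x \<ge> 2" for x using that by (simp add: d_def)
  have cont: "continuous_on {2..} D"
    using D by (auto simp: continuous_on_eq_continuous_within intro: DERIV_continuous)
  have mvt: "\<exists>z. x < z \<and> z < y \<and> D y - D x = (y - x) * d z" if "2 \<le> x" "x < y" for x y
  proof -
    have "(D has_derivative (*) (d u)) (at u within {x..y})" if "x \<le> u" "u \<le> y" for u
      using has_derivative_subset[OF D[of u, unfolded has_field_derivative_def]] that \<open>2 \<le> x\<close> by auto
    from mvt_simple[OF \<open>x < y\<close> this] show ?thesis by (auto simp: mult.commute)
  qed
  have mono: "D x < D y" if "2 \<le> x" "x < y" for x y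
  proof -
    obtain z where "x < z" "z < y" "D y - D x = (y - x) * d z" using mvt[OF \<open>2 \<le> x\<close> \<open>x < y\<close>] by blast
    moreover have "(y - x) * d z > 0" using d_pos[of z] \<open>x < z\<close> that by simp
    ultimately show ?thesis by simp
  qed
  have "pi_star 2 M > 0"
    unfolding pi_star_def by (intro mult_pos_pos sum_pos) auto
  hence D2: "D 2 < 0" by (simp add: D_def Li_def)
  define e where "e = fact (M+1) / (2 * - D 2)"
  have "e > 0" unfolding e_def using D2 by (intro divide_pos_pos) auto
  have "\<forall>\<^sub>F t::real in at_top. t ^ (M+2) / exp t < e"
    using order_tendstoD(2)[OF tendsto_power_div_exp_0 \<open>e > 0\<close>] .
  from eventually_conj[OF this eventually_ge_at_top[of 3]]
  obtain t :: real where t: "t ^ (M+2) / exp t < e" "t \<ge> 3"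
    using eventually_happens by force
  have exp4: "exp t \<ge> 4" using exp_ge_add_one_self[of t] t by linarith
  obtain z where z: "2 < z" "z < exp t" "D (exp t) - D 2 = (exp t - 2) * d z"
    using mvt[of 2 "exp t"] exp4 by auto
  have "ln z < t" using z by (metis ln_exp ln_less_cancel_iff exp_gt_zero less_trans zero_less_numeral)
  hence dz: "d z \<ge> fact (M+1) / t ^ (M+2)"
    unfolding d_def using z t(2) by (intro divide_left_mono power_mono mult_pos_pos zero_less_power) auto
  have "t ^ (M+2) * (2 * - D 2) < fact (M+1) * exp t"
    using t D2 by (simp add: e_def field_simps del: fact_Suc power_Suc)
  hence "- D 2 < exp t / 2 * (fact (M+1) / t ^ (M+2))"
    using t(2) by (simp add: field_simps del: fact_Suc power_Suc)
  also have "\<dots> \<le> (exp t - 2) * d z"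
    using exp4 t(2) by (intro mult_mono dz) auto
  finally have "D (exp t) > 0" using z by simp
  moreover have "continuous_on {2..exp t} D" by (rule continuous_on_subset[OF cont]) auto
  ultimately obtain x where x: "2 \<le> x" "D x = 0"
    using IVT'[of D 2 0 "exp t"] D2 exp4 by auto
  hence "x > 2" using D2 by (cases "x = 2") auto
  show ?thesis
  proof (rule ex1I[of _ x])
    show "x > 2 \<and> Li x = pi_star x M" using x \<open>x > 2\<close> by (simp add: D_def)
    fix y assume "y > 2 \<and> Li y = pi_star y M"
    hence "y > 2" "D y = 0" by (auto simp: D_def)
    thus "y = x" using mono[of x y] mono[of y x] x by (cases x y rule: linorder_cases) auto
  qed
qed

end

theory Submission
  imports Defs
begin

text \<open>Write \<open>x\<^sub>M\<close> for \<open>x_L M\<close>, \<open>t\<^sub>M = ln x\<^sub>M\<close> and \<open>d\<^sub>M = t\<^sub>M\<^sub>+\<^sub>1 - t\<^sub>M = ln (alpha_L M)\<close>. Both claims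
  follow once \<open>d\<^sub>M\<close> tends to \<open>1\<close>. The idea is to avoid the asymptotic expansion of the logarithmic
  integral and to read everything off a recursion for the numbers \<open>t\<^sub>M\<close> alone.

  The difference \<open>Li x - pi_star x (M+1)\<close> is known at \<open>x\<^sub>M\<close>, where it is minus the last
  term of \<open>pi_star x (M+1)\<close>, and at \<open>x\<^sub>M\<^sub>+\<^sub>1\<close>, where it vanishes; and its derivative is the elementary function
  \<open>(M+2)! / (ln x)^(M+3)\<close>. Integrating the derivative between the two points and substituting
  \<open>x = exp (t\<^sub>M + s)\<close> yields an exact equation for the gap (lemma \<open>gap_equation\<close>):
  the integral of \<open>exp s / (1 + s / t\<^sub>M)^(M+3)\<close> over \<open>0 \<le> s \<le> d\<^sub>M\<close> equals \<open>r\<^sub>M = t\<^sub>M / (M+2)\<close>.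
  The integrand is roughly \<open>exp (s (1 - 1/r\<^sub>M))\<close>. Hence it is close to \<open>1\<close>, and \<open>d\<^sub>M\<close> close
  to \<open>r\<^sub>M\<close>, as soon as \<open>r\<^sub>M\<close> is close to \<open>1\<close>; it remains to see that \<open>r\<^sub>M\<close> tends to \<open>1\<close>.

  This is a stability property of the recursion, whatever its initial value. If \<open>r\<^sub>M < 1\<close>, the
  integrand is small, so the interval must be longer than \<open>r\<^sub>M\<close>; if \<open>r\<^sub>M\<close> exceeds \<open>1\<close> it is large
  and the interval must be shorter. Since \<open>r\<^sub>M\<^sub>+\<^sub>1 - r\<^sub>M = (d\<^sub>M - r\<^sub>M) / (M+3)\<close>, the ratio
  drifts towards \<open>1\<close>, except perhaps in a window of width \<open>1 / (M+2)\<close> above \<open>1\<close>. As long as it stays away from \<open>1\<close> by \<open>\<epsilon>\<close>, its steps are at least a constant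
  times \<open>1 / (M+3)\<close>, and the divergence of the harmonic series forces it into the
  \<open>\<epsilon>\<close>-neighbourhood, which it eventually cannot leave
  (lemmas \<open>eventually_ratio_ge\<close> and \<open>eventually_ratio_le\<close>).\<close>

section \<open>The equation for the gap between consecutive solutions\<close>

lemma x_L_gt_2: "x_L M > 2"
  and Li_x_L: "Li (x_L M) = pi_star (x_L M) M"
  using theI'[OF ex1_x_L[of M]] by (auto simp: x_L_def)

definition log_x :: "nat \<Rightarrow> real" where
  "log_x M = ln (x_L M)"

definition gap :: "nat \<Rightarrow> real" where
  "gap M = log_x (M + 1) - log_x M"

text \<open>Up to a constant factor, \<open>weight (M + 2) t s\<close> is the derivative in \<open>s\<close> of
  \<open>Li x - pi_star x (M + 1)\<close> at \<open>x = exp (t + s)\<close>, scaled to the value \<open>1\<close> at \<open>s = 0\<close>.\<close>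
definition weight :: "nat \<Rightarrow> real \<Rightarrow> real \<Rightarrow> real" where
  "weight m t s = exp s / (1 + s / t) ^ (m + 1)"

lemma exp_log_x: "exp (log_x M) = x_L M"
  using x_L_gt_2[of M] by (simp add: log_x_def)

lemma log_x_pos: "log_x M > 0"
  using x_L_gt_2[of M] by (simp add: log_x_def)

lemma alpha_L_eq_exp_gap: "alpha_L M = exp (gap M)"
  by (simp add: alpha_L_def gap_def exp_diff exp_log_x)

lemma Li_minus_pi_star_has_derivative:
  assumes "x > 2"
  shows "((\<lambda>x. Li x - pi_star x M) has_real_derivative fact (M+1) / ln x ^ (M+2)) (at x)"
proof -
  have "at x within {2..} = at x"
    using assms by (intro at_within_interior) simp
  then have "(Li has_real_derivative 1 / ln x) (at x)"
    using Li_has_derivative[of x] assms by simp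
  from DERIV_diff[OF this pi_star_has_derivative[of x M]] show ?thesis
    using assms by (simp del: fact_Suc)
qed

lemma Li_minus_pi_star_strict_mono:
  assumes "2 < x" "x < y"
  shows "Li x - pi_star x M < Li y - pi_star y M"
proof (rule DERIV_pos_imp_increasing[OF \<open>x < y\<close>])
  fix z assume "x \<le> z"
  then show "\<exists>d. ((\<lambda>x. Li x - pi_star x M) has_real_derivative d) (at z) \<and> d > 0"
    using Li_minus_pi_star_has_derivative[of z M] assms
    by (intro exI[of _ "fact (M+1) / ln z ^ (M+2)"]) (auto simp del: fact_Suc)
qed

lemma pi_star_Suc: "pi_star x (M + 1) = pi_star x M + x * fact (M+1) / ln x ^ (M+2)"
  by (simp add: pi_star_def distrib_left del: fact_Suc)

text \<open>This value is what makes the recursion self-contained: it involves \<open>Li\<close> only through the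
  equation that defines \<open>x_L M\<close>.\<close>
lemma Li_minus_next_pi_star_at_x_L:
  "Li (x_L M) - pi_star (x_L M) (M + 1) = - (x_L M * fact (M+1) / log_x M ^ (M+2))"
  unfolding pi_star_Suc Li_x_L log_x_def by (simp del: fact_Suc)

text \<open>The next difference is still negative at \<open>x_L M\<close>, so its zero lies further to the right.\<close>
lemma gap_pos: "gap M > 0"
proof (rule ccontr)
  assume "\<not> gap M > 0"
  then have "x_L (M+1) \<le> x_L M"
    by (simp add: gap_def flip: exp_log_x)
  then have "Li (x_L (M+1)) - pi_star (x_L (M+1)) (M+1) \<le> Li (x_L M) - pi_star (x_L M) (M+1)"
    using Li_minus_pi_star_strict_mono[OF x_L_gt_2, of "M+1" "x_L M" "M+1"]
    by (cases "x_L (M+1) = x_L M") auto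
  moreover have "x_L M * fact (M+1) / log_x M ^ (M+2) > 0"
    using x_L_gt_2[of M] log_x_pos[of M] by (intro divide_pos_pos mult_pos_pos) auto
  ultimately show False
    unfolding Li_minus_next_pi_star_at_x_L by (simp add: Li_x_L del: fact_Suc)
qed

text \<open>The fundamental theorem of calculus for \<open>Li - pi_star\<close> of order \<open>M + 1\<close> between \<open>x_L M\<close> and
  \<open>x_L (M + 1)\<close>, on the logarithmic scale.\<close>
lemma gap_equation:
  "(weight (M + 2) (log_x M) has_integral log_x M / (M + 2)) {0..gap M}"
proof -
  define t where "t = log_x M"
  have t: "t > 0" "exp t > 2"
    using log_x_pos[of M] x_L_gt_2[of M] by (simp_all add: t_def exp_log_x)
  define D where "D x = Li x - pi_star x (M + 1)" for x
  \<comment> \<open>The factor normalizes the derivative of \<open>W\<close> at \<open>0\<close> to \<open>1\<close>.\<close>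
  define W where "W s = D (exp (t + s)) * (t ^ (M+3) / (exp t * fact (M+2)))" for s
  have deriv: "(W has_real_derivative weight (M+2) t s) (at s)" if "s \<ge> 0" for s
  proof -
    have "exp t \<le> exp (t + s)"
      using that by simp
    then have "exp (t + s) > 2"
      using t(2) by linarith
    from Li_minus_pi_star_has_derivative[OF this, of "M+1"]
    have "(D has_real_derivative fact (M+2) / (t + s) ^ (M+3)) (at (exp (t + s)))"
      by (simp add: D_def[abs_def] eval_nat_numeral del: fact_Suc)
    moreover have "((\<lambda>s. exp (t + s)) has_real_derivative exp (t + s)) (at s)"
      by (auto intro!: derivative_eq_intros)
    ultimately have "(W has_real_derivative
        fact (M+2) / (t + s) ^ (M+3) * exp (t + s) * (t ^ (M+3) / (exp t * fact (M+2)))) (at s)"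
      unfolding W_def by (intro DERIV_cmult_right DERIV_chain2)
    also have "fact (M+2) / (t + s) ^ (M+3) * exp (t + s) * (t ^ (M+3) / (exp t * fact (M+2)))
        = exp s * (t / (t + s)) ^ (M+3)"
      by (simp add: exp_add power_divide del: fact_Suc power_Suc add_2_eq_Suc')
    also have "t / (t + s) = 1 / (1 + s / t)"
      using t that by (simp add: field_simps)
    also have "exp s * (1 / (1 + s / t)) ^ (M+3) = weight (M+2) t s"
      by (simp add: weight_def power_divide eval_nat_numeral)
    finally show ?thesis .
  qed
  have "(weight (M+2) t has_integral (W (gap M) - W 0)) {0..gap M}"
    using gap_pos[of M] deriv
    by (intro fundamental_theorem_of_calculus)
       (auto simp flip: has_real_derivative_iff_has_vector_derivative intro: has_field_derivative_at_within)
  moreover have "W (gap M) = 0"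
    using Li_x_L[of "M+1"] by (simp add: W_def D_def t_def gap_def exp_log_x)
  moreover have "W 0 = - (t / (M+2))"
  proof -
    have "fact (M+2) = (real (M+2) * fact (M+1) :: real)"
      by (simp add: eval_nat_numeral)
    moreover have "t ^ (M+3) = t * t ^ (M+2)"
      by (simp add: eval_nat_numeral)
    ultimately have "W 0 = - (exp t * fact (M+1) / t ^ (M+2)) *
        (t * t ^ (M+2) / (exp t * (real (M+2) * fact (M+1))))"
      using Li_minus_next_pi_star_at_x_L[of M]
      by (simp add: W_def D_def t_def exp_log_x del: fact_Suc power_Suc)
    also have "\<dots> = - (t / (M+2))"
    proof -
      \<comment> \<open>Abstracting the factorials and powers keeps the simplifier from expanding them.\<close>
      have "- (E * F / P) * (t * P / (E * (m * F))) = - (t / m)"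
        if "E \<noteq> 0" "F \<noteq> 0" "P \<noteq> 0" "m \<noteq> 0" for E F P m :: real
        using that by simp
      from this[of "exp t" "fact (M+1)" "t ^ (M+2)" "real (M+2)"] show ?thesis
        using t(1) by simp
    qed
    finally show ?thesis .
  qed
  ultimately show ?thesis
    by (simp add: t_def)
qed

section \<open>Bounds for the gap\<close>

text \<open>Both bounds compare the power in the denominator with an exponential:
  \<open>1 + u \<le> exp u\<close> bounds the weight from below and \<open>1 / (1 + u) \<le> exp (- u / (1 + u))\<close>
  bounds it from above. The tangent line of \<open>exp\<close> suffices in the lower bound, and an affine
  function keeps the integrals explicit.\<close>
lemma weight_ge_linear:
  assumes "t > 0" "s \<ge> 0"
  shows "1 + s * (1 - (real m + 1) / t) \<le> weight m t s"
proof -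
  have "(1 + s / t) ^ (m + 1) \<le> exp (s / t) ^ (m + 1)"
    using assms by (intro power_mono) auto
  also have "\<dots> = exp (s * ((real m + 1) / t))"
    by (subst exp_of_nat_mult[symmetric]) (simp add: field_simps)
  finally have "exp s / exp (s * ((real m + 1) / t)) \<le> weight m t s"
    unfolding weight_def using assms by (intro divide_left_mono) (auto intro!: mult_pos_pos zero_less_power add_pos_nonneg)
  moreover have "exp s / exp (s * ((real m + 1) / t)) = exp (s * (1 - (real m + 1) / t))"
    by (simp add: exp_diff[symmetric] algebra_simps)
  ultimately show ?thesis
    using exp_ge_add_one_self[of "s * (1 - (real m + 1) / t)"] by linarith
qed

lemma weight_le_exp:
  assumes "t > 0" "s \<ge> 0"
  shows "weight m t s \<le> exp (s * (t + s - (real m + 1)) / (t + s))"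
proof -
  have "1 - s / (t + s) \<le> exp (- (s / (t + s)))"
    using exp_ge_add_one_self[of "- (s / (t + s))"] by simp
  moreover have "1 - s / (t + s) = inverse (1 + s / t)"
    using assms by (simp add: field_simps)
  ultimately have "inverse (1 + s / t) \<le> exp (- (s / (t + s)))"
    by simp
  then have "inverse (1 + s / t) ^ (m + 1) \<le> exp (- (s / (t + s))) ^ (m + 1)"
    using assms by (intro power_mono) auto
  also have "\<dots> = exp (- (s * (real m + 1) / (t + s)))"
    by (subst exp_of_nat_mult[symmetric]) (simp add: field_simps)
  finally have "weight m t s \<le> exp s * exp (- (s * (real m + 1) / (t + s)))"
    unfolding weight_def divide_inverse power_inverse by simp
  also have "\<dots> = exp (s * (t + s - (real m + 1)) / (t + s))"
  proof -
    have "s = s * (t + s) / (t + s)"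
      using assms by simp
    then have "s - s * (real m + 1) / (t + s) = s * (t + s - (real m + 1)) / (t + s)"
      by (metis diff_divide_distrib right_diff_distrib)
    then show ?thesis
      by (metis exp_add diff_conv_add_uminus)
  qed
  finally show ?thesis .
qed

lemma has_integral_affine:
  fixes a b c :: real
  assumes "b \<ge> 0"
  shows "((\<lambda>s. a + c * s) has_integral (a * b + c * b\<^sup>2 / 2)) {0..b}"
proof -
  have "((\<lambda>s. a + c * s) has_integral ((a * b + c * b\<^sup>2 / 2) - (a * 0 + c * 0\<^sup>2 / 2))) {0..b}"
    using assms
    by (intro fundamental_theorem_of_calculus)
       (auto intro!: derivative_eq_intros simp flip: has_real_derivative_iff_has_vector_derivative)
  then show ?thesis by simp
qed

text \<open>The right-hand side of the gap equation, and the quantity that the recursion drives to \<open>1\<close>.\<close>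
definition ratio :: "nat \<Rightarrow> real" where
  "ratio M = log_x M / (real M + 2)"

lemma ratio_pos: "ratio M > 0"
  using log_x_pos[of M] by (simp add: ratio_def)

text \<open>The slope in \<open>weight_ge_linear\<close> is \<open>1\<close> minus this quotient, which differs from the reciprocal
  of the ratio by a factor tending to \<open>1\<close>.\<close>
lemma shift_div_log_x: "(real M + 3) / log_x M = (1 + 1 / (real M + 2)) / ratio M"
proof -
  have "1 + 1 / (real M + 2) = (real M + 3) / (real M + 2)"
    by (simp add: field_simps)
  then show ?thesis
    by (simp add: ratio_def)
qed

text \<open>The sign of \<open>gap M - ratio M\<close> thus decides in which direction the ratio moves.\<close>
lemma ratio_Suc: "ratio (M + 1) - ratio M = (gap M - ratio M) / (real M + 3)"
  by (simp add: ratio_def gap_def field_simps)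

text \<open>The lower bound for the weight, integrated. As the weight is nonnegative, the integral over
  \<open>{0..b}\<close> is at most the one over \<open>{0..gap M}\<close>; this freedom in \<open>b\<close> serves to bound the gap when
  the slope is negative and the parabola is not monotone.\<close>
lemma quadratic_le_ratio:
  assumes "0 \<le> b" "b \<le> gap M"
  shows "b + (1 - (real M + 3) / log_x M) * b\<^sup>2 / 2 \<le> ratio M"
proof -
  define t where "t = log_x M"
  have t: "t > 0"
    using log_x_pos by (simp add: t_def)
  have int: "(weight (M+2) t has_integral ratio M) {0..gap M}"
    using gap_equation[of M] by (simp add: t_def ratio_def add.commute)
  have sub: "weight (M+2) t integrable_on {0..b}"
    using assms by (intro integrable_on_subinterval[OF has_integral_integrable[OF int]]) auto
  have "((\<lambda>s. 1 + (1 - (real M + 3) / t) * s) has_integral (1 * b + (1 - (real M + 3) / t) * b\<^sup>2 / 2)) {0..b}"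
    by (rule has_integral_affine[OF assms(1)])
  then have "1 * b + (1 - (real M + 3) / t) * b\<^sup>2 / 2 \<le> integral {0..b} (weight (M+2) t)"
    using weight_ge_linear[OF t, of _ "M+2"]
    by (intro has_integral_le[OF _ integrable_integral[OF sub]]) (auto simp: mult.commute add.commute)
  also have "\<dots> \<le> integral {0..gap M} (weight (M+2) t)"
    using assms t has_integral_integrable[OF int] sub
    by (intro integral_subset_le) (auto simp: weight_def)
  also have "\<dots> = ratio M"
    using int by (rule integral_unique)
  finally show ?thesis
    by (simp add: t_def)
qed

lemma ratio_le_quadratic:
  assumes "\<And>s. 0 \<le> s \<Longrightarrow> s \<le> gap M \<Longrightarrow> weight (M + 2) (log_x M) s \<le> a + c * s"
  shows "ratio M \<le> a * gap M + c * (gap M)\<^sup>2 / 2"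
proof -
  have "(weight (M+2) (log_x M) has_integral ratio M) {0..gap M}"
    using gap_equation[of M] by (simp add: ratio_def add.commute)
  moreover have "((\<lambda>s. a + c * s) has_integral (a * gap M + c * (gap M)\<^sup>2 / 2)) {0..gap M}"
    using gap_pos[of M] by (intro has_integral_affine) simp
  ultimately show ?thesis
    by (rule has_integral_le) (use assms in auto)
qed

text \<open>For \<open>log_x M \<le> M + 2\<close> the exponent in \<open>weight_le_exp\<close> is nonpositive up to \<open>s = 1\<close>, so the
  weight is at most \<open>1\<close> there and an interval shorter than \<open>ratio M\<close> cannot carry the integral.\<close>
lemma ratio_le_gap:
  assumes "ratio M \<le> 1"
  shows "ratio M \<le> gap M"
proof (cases "gap M \<le> 1")
  case True
  have t: "log_x M \<le> real M + 2" "log_x M > 0"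
    using assms log_x_pos by (auto simp: ratio_def)
  have "weight (M + 2) (log_x M) s \<le> 1 + 0 * s" if "0 \<le> s" "s \<le> gap M" for s
  proof -
    have "s * (log_x M + s - (real (M + 2) + 1)) / (log_x M + s) \<le> 0"
      using t that True by (intro divide_nonpos_nonneg mult_nonneg_nonpos) auto
    then have "exp (s * (log_x M + s - (real (M + 2) + 1)) / (log_x M + s)) \<le> 1"
      by (subst exp_le_one_iff)
    with weight_le_exp[OF t(2) that(1), of "M+2"] have "weight (M + 2) (log_x M) s \<le> 1"
      by (rule order_trans)
    then show ?thesis
      by simp
  qed
  from ratio_le_quadratic[OF this] show ?thesis by simp
qed (use assms in simp)

lemma exp_minus_le_affine:
  fixes u :: real
  assumes "0 \<le> u" "u \<le> 1"
  shows "exp (-u) \<le> 1 - u / 2"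
proof -
  have "1 \<le> (1 - u / 2) * (1 + u)"
    using assms mult_nonneg_nonneg[of u "1 - u"] by (simp add: algebra_simps)
  also have "\<dots> \<le> (1 - u / 2) * exp u"
    using assms exp_ge_add_one_self[of u] by (intro mult_left_mono) auto
  finally show ?thesis
    by (simp add: exp_minus field_simps)
qed

text \<open>Quantitative form of the previous argument: now the exponent is at most \<open>- \<epsilon> s / 2\<close> on
  \<open>{0..1}\<close>, which makes the weight at most \<open>1 - \<epsilon> s / 4\<close>. If the gap exceeds \<open>1\<close>, it
  exceeds the ratio by more than \<open>\<epsilon>\<close> anyway.\<close>
lemma gap_minus_ratio_ge:
  assumes "ratio M \<le> 1 - \<epsilon>" "0 < \<epsilon>"
  shows "gap M - ratio M \<ge> \<epsilon> * (ratio M)\<^sup>2 / 8"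
proof (cases "gap M \<le> 1")
  case True
  have t: "log_x M \<le> (1 - \<epsilon>) * (real M + 2)" "log_x M > 0"
    using assms(1) log_x_pos by (simp_all add: ratio_def pos_divide_le_eq)
  have \<epsilon>: "\<epsilon> < 1"
    using assms ratio_pos[of M] by simp
  have "weight (M + 2) (log_x M) s \<le> 1 + (- \<epsilon> / 4) * s" if "0 \<le> s" "s \<le> gap M" for s
  proof -
    define t where "t = log_x M"
    have "t + s - (real M + 3) \<le> - (\<epsilon> * (real M + 2))"
      using t(1) that(2) True by (simp add: t_def left_diff_distrib)
    moreover have "\<epsilon> * (real M + 2) \<ge> \<epsilon> * ((real M + 3) / 2)"
      using assms(2) by (intro mult_left_mono) auto
    moreover have "\<epsilon> * (real M + 2) \<ge> 0"
      using assms(2) by simp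
    then have "\<epsilon> * ((t + s) / 2) \<le> \<epsilon> * ((real M + 3) / 2)"
      using calculation(1) assms(2) by (intro mult_left_mono divide_right_mono) linarith+
    ultimately have "t + s - (real M + 3) \<le> - \<epsilon> / 2 * (t + s)"
      by simp
    then have "(t + s - (real M + 3)) / (t + s) \<le> - \<epsilon> / 2"
      using t that by (simp add: t_def pos_divide_le_eq)
    then have le: "s * ((t + s - (real M + 3)) / (t + s)) \<le> s * (- \<epsilon> / 2)"
      using that by (intro mult_left_mono) auto
    have u: "0 \<le> s * \<epsilon> / 2" "s * \<epsilon> / 2 \<le> 1"
      using that True assms \<epsilon> mult_mono[of s 1 \<epsilon> 1] by auto
    have "weight (M + 2) t s \<le> exp (s * ((t + s - (real M + 3)) / (t + s)))"
      using weight_le_exp[OF t(2) that(1), of "M+2"] by (simp add: t_def add.commute)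
    also have "\<dots> \<le> exp (- (s * \<epsilon> / 2))"
      using le by simp
    also have "\<dots> \<le> 1 - (s * \<epsilon> / 2) / 2"
      using u by (rule exp_minus_le_affine)
    finally show ?thesis
      by (simp add: t_def mult.commute)
  qed
  from ratio_le_quadratic[OF this]
  have "ratio M \<le> gap M - \<epsilon> / 8 * (gap M)\<^sup>2"
    by simp
  moreover have "\<epsilon> / 8 * (gap M)\<^sup>2 \<ge> \<epsilon> / 8 * (ratio M)\<^sup>2"
    using ratio_le_gap[of M] assms ratio_pos[of M] by (intro mult_left_mono power_mono) auto
  ultimately show ?thesis by simp
next
  case False
  have "(ratio M)\<^sup>2 \<le> 1"
    using assms ratio_pos[of M] by (simp add: power_le_one)
  then have "\<epsilon> * (ratio M)\<^sup>2 / 8 \<le> \<epsilon>"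
    using assms by (simp add: mult_left_le)
  then show ?thesis
    using assms False by linarith
qed

text \<open>Here the slope in \<open>weight_ge_linear\<close> is nonnegative, so the weight is at least \<open>1\<close>. Note the
  threshold \<open>M + 3\<close>, one more than in \<open>ratio_le_gap\<close>; in the window between the two thresholds the
  direction of the drift is left open.\<close>
lemma gap_le_ratio:
  assumes "log_x M \<ge> real M + 3"
  shows "gap M \<le> ratio M"
proof -
  have "(1 - (real M + 3) / log_x M) * (gap M)\<^sup>2 / 2 \<ge> 0"
    using assms by simp
  then show ?thesis
    using quadratic_le_ratio[of "gap M" M] gap_pos[of M] by linarith
qed

text \<open>Quantitative form: the slope is at least \<open>\<epsilon> / (2 (1 + \<epsilon>))\<close>. A gap above \<open>1\<close> makes the
  quadratic term contribute half of that; a gap of at most \<open>1\<close> is already below the ratio by \<open>\<epsilon>\<close>.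
  The bound on \<open>1 / (M + 2)\<close> absorbs the shift between the thresholds \<open>M + 2\<close> and \<open>M + 3\<close>.\<close>
lemma ratio_minus_gap_ge:
  assumes "ratio M \<ge> 1 + \<epsilon>" "0 < \<epsilon>" "1 / (real M + 2) \<le> \<epsilon> / 2"
  shows "ratio M - gap M \<ge> \<epsilon> / (4 * (1 + \<epsilon>))"
proof (cases "gap M \<le> 1")
  case True
  have "\<epsilon> / (4 * (1 + \<epsilon>)) \<le> \<epsilon>"
    using assms(2) by (simp add: field_simps)
  then show ?thesis
    using True assms(1) by linarith
next
  case False
  have "(real M + 3) / log_x M = (1 + 1 / (real M + 2)) / ratio M"
    by (rule shift_div_log_x)
  also have "\<dots> \<le> (1 + \<epsilon> / 2) / (1 + \<epsilon>)"
    using assms by (intro frac_le) auto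
  also have "\<dots> = 1 - \<epsilon> / (2 * (1 + \<epsilon>))"
    using assms(2) by (simp add: field_simps)
  finally have "\<epsilon> / (2 * (1 + \<epsilon>)) \<le> 1 - (real M + 3) / log_x M"
    by simp
  then have ge: "\<epsilon> / (2 * (1 + \<epsilon>)) * 1 \<le> (1 - (real M + 3) / log_x M) * (gap M)\<^sup>2"
  proof (rule mult_mono)
    have "0 \<le> \<epsilon> / (2 * (1 + \<epsilon>))"
      using assms(2) by simp
    also note \<open>\<dots> \<le> 1 - (real M + 3) / log_x M\<close>
    finally show "0 \<le> 1 - (real M + 3) / log_x M" .
  qed (use False in \<open>auto simp: one_le_power\<close>)
  have "\<epsilon> / (4 * (1 + \<epsilon>)) = \<epsilon> / (2 * (1 + \<epsilon>)) * 1 / 2"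
    using assms(2) by (simp add: field_simps)
  also have "\<dots> \<le> (1 - (real M + 3) / log_x M) * (gap M)\<^sup>2 / 2"
    by (intro divide_right_mono ge) simp
  also have "\<dots> \<le> ratio M - gap M"
    using quadratic_le_ratio[OF less_imp_le[OF gap_pos] order_refl]
    by (simp only: le_diff_eq add.commute)
  finally show ?thesis .
qed

section \<open>The ratio tends to one\<close>

lemma harmonic_increments_unbounded:
  fixes f :: "nat \<Rightarrow> real"
  assumes "c > 0" and incr: "\<And>k. k \<ge> N \<Longrightarrow> c / (real k + 3) \<le> f (k + 1) - f k"
  shows "\<exists>k\<ge>N. f k > B"
proof (rule ccontr)
  assume "\<not> ?thesis"
  then have bound: "f k \<le> B" if "k \<ge> N" for k
    using that by force
  have sum: "c * (\<Sum>j<k. 1 / real (j + N + 3)) \<le> f (N + k) - f N" for k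
  proof (induction k)
    case (Suc k)
    then show ?case
      using incr[of "N + k"] by (simp add: algebra_simps)
  qed simp
  have "summable (\<lambda>j. 1 / real (j + (N + 3)))"
  proof (rule summableI_nonneg_bounded)
    fix k
    show "(\<Sum>j<k. 1 / real (j + (N + 3))) \<le> (B - f N) / c"
      using sum[of k] bound[of "N + k"] \<open>c > 0\<close>
      by (simp add: field_simps add.assoc)
  qed simp
  then have "summable (\<lambda>j. 1 / real j)"
    by (subst (asm) summable_iff_shift)
  then show False
    using not_summable_harmonic[where 'a = real] by (simp add: inverse_eq_divide)
qed

text \<open>While the ratio is below \<open>1 - \<epsilon>\<close> it increases, hence the bound in \<open>gap_minus_ratio_ge\<close>
  stays away from \<open>0\<close> and the harmonic series drives the ratio up. Afterwards it cannot
  return: it does not decrease from values at most \<open>1\<close>, and a single step from above \<open>1\<close>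
  reduces it at worst to \<open>(M + 2) / (M + 3)\<close>, because \<open>log_x\<close> is increasing.\<close>
lemma eventually_ratio_ge:
  assumes "\<epsilon> > 0"
  shows "eventually (\<lambda>M. ratio M \<ge> 1 - \<epsilon>) sequentially"
proof -
  obtain N where N: "1 / \<epsilon> < real N"
    using reals_Archimedean2 by blast
  have "\<exists>M\<ge>N. ratio M \<ge> 1 - \<epsilon>"
  proof (rule ccontr)
    assume "\<not> ?thesis"
    then have below: "ratio M < 1 - \<epsilon>" if "M \<ge> N" for M
      using that by force
    have mono: "ratio M \<le> ratio (M + 1)" if "M \<ge> N" for M
    proof -
      have "gap M - ratio M \<ge> 0"
        using ratio_le_gap[of M] below[OF that] assms by simp
      then have "ratio (M + 1) - ratio M \<ge> 0"
        unfolding ratio_Suc by simp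
      then show ?thesis by simp
    qed
    have ge: "ratio N \<le> ratio M" if "M \<ge> N" for M
      using that
    proof (induction M rule: dec_induct)
      case (step M)
      then show ?case
        using mono[of M] by simp
    qed simp
    have "\<exists>M\<ge>N. ratio M > 1"
    proof (rule harmonic_increments_unbounded)
      show "\<epsilon> * (ratio N)\<^sup>2 / 8 > 0"
        using assms ratio_pos[of N] by simp
      fix M assume M: "M \<ge> N"
      have "\<epsilon> * (ratio N)\<^sup>2 / 8 \<le> \<epsilon> * (ratio M)\<^sup>2 / 8"
        using assms ge[OF M] ratio_pos[of N] by (simp add: power_mono)
      also have "\<dots> \<le> gap M - ratio M"
        using gap_minus_ratio_ge[of M \<epsilon>] below[OF M] assms by simp
      finally show "\<epsilon> * (ratio N)\<^sup>2 / 8 / (real M + 3) \<le> ratio (M + 1) - ratio M"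
        unfolding ratio_Suc by (intro divide_right_mono) auto
    qed
    then show False
      using below assms by force
  qed
  then obtain K where K: "K \<ge> N" "ratio K \<ge> 1 - \<epsilon>"
    by blast
  have "ratio M \<ge> 1 - \<epsilon>" if "M \<ge> K" for M
    using that
  proof (induction M rule: dec_induct)
    case base
    show ?case by (rule K)
  next
    case (step M)
    show ?case
    proof (cases "ratio M \<le> 1")
      case True
      then have "ratio (M + 1) - ratio M \<ge> 0"
        unfolding ratio_Suc using ratio_le_gap[of M] by simp
      then show ?thesis
        using step by simp
    next
      case False
      then have "log_x (M + 1) \<ge> real M + 2"
        using gap_pos[of M] by (simp add: ratio_def gap_def field_simps)
      then have "ratio (M + 1) \<ge> (real M + 2) / (real M + 3)"
        by (simp add: ratio_def divide_right_mono add.commute)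
      moreover have "1 \<le> \<epsilon> * (real M + 3)"
      proof -
        have "1 \<le> \<epsilon> * N"
          using N assms by (simp add: field_simps)
        also have "\<dots> \<le> \<epsilon> * (real M + 3)"
          using step K(1) assms by simp
        finally show ?thesis .
      qed
      then have "(real M + 2) / (real M + 3) \<ge> 1 - \<epsilon>"
        by (simp add: field_simps)
      ultimately show ?thesis
        by simp
    qed
  qed
  then show ?thesis
    by (auto simp: eventually_sequentially)
qed

text \<open>With a slope of at least \<open>- 1 / 4\<close> the parabola of \<open>quadratic_le_ratio\<close> has at \<open>b = 2\<close> a value
  of at least \<open>3 / 2\<close>, too much for the ratio.\<close>
lemma gap_le_2:
  assumes "ratio M \<le> 5 / 4" "(real M + 3) / log_x M \<le> 5 / 4"
  shows "gap M \<le> 2"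
proof (rule ccontr)
  define q where "q = (real M + 3) / log_x M"
  assume "\<not> gap M \<le> 2"
  then have "2 + (1 - q) * 2\<^sup>2 / 2 \<le> ratio M"
    unfolding q_def by (intro quadratic_le_ratio) auto
  moreover have "q \<le> 5 / 4"
    using assms(2) by (simp only: q_def)
  ultimately show False
    using assms(1) by (simp add: power2_eq_square diff_divide_distrib)
qed

lemma eventually_shift_div_log_x_le:
  "eventually (\<lambda>M. (real M + 3) / log_x M \<le> 5 / 4) sequentially"
proof -
  have "eventually (\<lambda>M. ratio M \<ge> 1 - 1 / 10) sequentially"
    by (rule eventually_ratio_ge) simp
  then show ?thesis
    using eventually_ge_at_top[of 10]
  proof eventually_elim
    case (elim M)
    then have "9 * (real M + 2) \<le> 10 * log_x M"
      by (simp add: ratio_def field_simps)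
    then show ?case
      using elim(2) log_x_pos[of M] by (simp add: field_simps)
  qed
qed

text \<open>The mirror image of \<open>eventually_ratio_ge\<close>, except for the way back: from below the
  threshold \<open>M + 3\<close> a long gap could carry the ratio beyond \<open>1 + \<epsilon>\<close>. The lower estimate for the
  ratio is therefore used first, to make the gap at most \<open>2\<close>.\<close>
lemma eventually_ratio_le:
  assumes "\<epsilon> > 0"
  shows "eventually (\<lambda>M. ratio M \<le> 1 + \<epsilon>) sequentially"
proof -
  obtain A where A: "\<And>M. M \<ge> A \<Longrightarrow> (real M + 3) / log_x M \<le> 5 / 4"
    using eventually_shift_div_log_x_le by (auto simp: eventually_sequentially)
  obtain B where B: "2 / \<epsilon> < real B"
    using reals_Archimedean2 by blast
  \<comment> \<open>From \<open>4\<close> on, \<open>(M + 3) / (M + 2) \<le> 5 / 4\<close>, as required by \<open>gap_le_2\<close>.\<close>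
  define N where "N = max A (max B 4)"
  have N: "N \<ge> A" "2 / \<epsilon> < real N" "N \<ge> 4"
    using B by (auto simp: N_def)
  have small: "2 \<le> \<epsilon> * M" if "M \<ge> N" for M
  proof -
    have "2 \<le> \<epsilon> * N"
      using N assms by (simp add: field_simps)
    also have "\<dots> \<le> \<epsilon> * M"
      using that assms by simp
    finally show ?thesis .
  qed
  have "\<exists>M\<ge>N. ratio M \<le> 1 + \<epsilon>"
  proof (rule ccontr)
    assume "\<not> ?thesis"
    then have above: "ratio M > 1 + \<epsilon>" if "M \<ge> N" for M
      using that by force
    have "\<exists>M\<ge>N. - ratio M > 0"
    proof (rule harmonic_increments_unbounded)
      show "\<epsilon> / (4 * (1 + \<epsilon>)) > 0"
        using assms by simp
      fix M assume M: "M \<ge> N"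
      have "1 / (real M + 2) \<le> \<epsilon> / 2"
        using small[OF M] assms by (simp add: field_simps)
      then have "\<epsilon> / (4 * (1 + \<epsilon>)) \<le> ratio M - gap M"
        using above[OF M] assms by (intro ratio_minus_gap_ge) auto
      then have "\<epsilon> / (4 * (1 + \<epsilon>)) / (real M + 3) \<le> (ratio M - gap M) / (real M + 3)"
        by (rule divide_right_mono) simp
      also have "\<dots> = - ratio (M + 1) - - ratio M"
        using ratio_Suc[of M] by (simp add: diff_divide_distrib)
      finally show "\<epsilon> / (4 * (1 + \<epsilon>)) / (real M + 3) \<le> - ratio (M + 1) - - ratio M" .
    qed
    then show False
      using ratio_pos by (meson less_asym neg_0_less_iff_less)
  qed
  then obtain K where K: "K \<ge> N" "ratio K \<le> 1 + \<epsilon>"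
    by blast
  have "ratio M \<le> 1 + \<epsilon>" if "M \<ge> K" for M
    using that
  proof (induction M rule: dec_induct)
    case base
    show ?case by (rule K)
  next
    case (step M)
    have M: "M \<ge> N"
      using step K by simp
    show ?case
    proof (cases "log_x M \<ge> real M + 3")
      case True
      then have "(gap M - ratio M) / (real M + 3) \<le> 0"
        using gap_le_ratio[of M] by (intro divide_nonpos_nonneg) auto
      then have "ratio (M + 1) - ratio M \<le> 0"
        unfolding ratio_Suc .
      then show ?thesis
        using step by simp
    next
      case False
      then have "ratio M \<le> (real M + 3) / (real M + 2)"
        by (simp add: ratio_def divide_right_mono)
      also have "\<dots> \<le> 5 / 4"
        using M N(3) by (simp add: field_simps)
      finally have "gap M \<le> 2"
        using A[of M] M N(1) by (intro gap_le_2) auto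
      then have "log_x (M + 1) \<le> real M + 5"
        using False by (simp add: gap_def)
      then have "ratio (M + 1) \<le> (real M + 5) / (real M + 3)"
        by (simp add: ratio_def divide_right_mono add.commute)
      also have "\<dots> \<le> 1 + \<epsilon>"
        using small[OF M] assms by (simp add: field_simps)
      finally show ?thesis by simp
    qed
  qed
  then show ?thesis
    by (auto simp: eventually_sequentially)
qed

lemma ratio_tendsto_1: "ratio \<longlonglongrightarrow> 1"
proof (rule tendstoI)
  fix e :: real assume "e > 0"
  then have "eventually (\<lambda>M. ratio M \<ge> 1 - e / 2) sequentially"
            "eventually (\<lambda>M. ratio M \<le> 1 + e / 2) sequentially"
    by (intro eventually_ratio_ge eventually_ratio_le; simp)+
  then show "eventually (\<lambda>M. dist (ratio M) 1 < e) sequentially"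
    by eventually_elim (use \<open>e > 0\<close> in \<open>auto simp: dist_real_def\<close>)
qed

section \<open>The gap tends to one\<close>

text \<open>Now that the ratio tends to \<open>1\<close>, the slope in the lower bound and the exponent in the upper
  bound of the weight tend to \<open>0\<close> uniformly for \<open>0 \<le> s \<le> 2\<close>, and the gap is squeezed against
  the ratio.\<close>
lemma gap_tendsto_1: "gap \<longlonglongrightarrow> 1"
proof -
  define q where "q M = (real M + 3) / log_x M" for M
  have "(\<lambda>M. 1 + 1 / real (M + 2)) \<longlonglongrightarrow> 1 + 0"
    by (intro tendsto_intros LIMSEQ_ignore_initial_segment[OF lim_1_over_n])
  then have "(\<lambda>M. (1 + 1 / real (M + 2)) / ratio M) \<longlonglongrightarrow> (1 + 0) / 1"
    by (intro tendsto_divide ratio_tendsto_1) auto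
  moreover have "(1 + 1 / real (M + 2)) / ratio M = q M" for M
    by (simp add: q_def shift_div_log_x)
  ultimately have q: "q \<longlonglongrightarrow> 1"
    by (simp add: fun_eq_iff)
  have inv: "(\<lambda>M. 1 / log_x M) \<longlonglongrightarrow> 0"
  proof -
    have "(\<lambda>M. q M * (1 / real (M + 3))) \<longlonglongrightarrow> 1 * 0"
      by (intro tendsto_mult q LIMSEQ_ignore_initial_segment[OF lim_1_over_n])
    moreover have "q M * (1 / real (M + 3)) = 1 / log_x M" for M
      by (simp add: q_def field_simps)
    ultimately show ?thesis by simp
  qed
  have le_2: "eventually (\<lambda>M. gap M \<le> 2) sequentially"
  proof -
    have "eventually (\<lambda>M. ratio M \<le> 1 + 1 / 4) sequentially"
      by (rule eventually_ratio_le) simp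
    then show ?thesis
      using eventually_shift_div_log_x_le
      by eventually_elim (intro gap_le_2; simp)
  qed
  \<comment> \<open>A bound, for \<open>0 \<le> s \<le> 2\<close>, of the exponent in \<open>weight_le_exp\<close>.\<close>
  define \<eta> where "\<eta> M = 2 * (\<bar>1 - q M\<bar> + 2 * (1 / log_x M))" for M
  have lower: "eventually (\<lambda>M. ratio M / exp (\<eta> M) \<le> gap M) sequentially"
    using le_2
  proof eventually_elim
    case (elim M)
    define t where "t = log_x M"
    have t: "t > 0"
      using log_x_pos by (simp add: t_def)
    have "weight (M + 2) t s \<le> exp (\<eta> M) + 0 * s" if "0 \<le> s" "s \<le> gap M" for s
    proof -
      have s: "s \<le> 2"
        using that elim by simp
      have "s * (t + s - (real M + 3)) / (t + s) = s * ((t + s - (real M + 3)) / (t + s))"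
        by simp
      also have "\<dots> \<le> s * (\<bar>t + s - (real M + 3)\<bar> / t)"
        using t that by (intro mult_left_mono frac_le) auto
      also have "\<dots> \<le> 2 * ((\<bar>t - (real M + 3)\<bar> + 2) / t)"
        using t that s by (intro mult_mono divide_right_mono) auto
      also have "\<dots> = \<eta> M"
      proof -
        have "1 - q M = (t - (real M + 3)) / t"
          using t by (simp add: q_def t_def diff_divide_distrib)
        then have "\<bar>1 - q M\<bar> = \<bar>t - (real M + 3)\<bar> / t"
          using t by (simp add: abs_divide)
        then show ?thesis
          by (simp add: \<eta>_def t_def add_divide_distrib)
      qed
      finally have "exp (s * (t + s - (real M + 3)) / (t + s)) \<le> exp (\<eta> M)"
        by simp
      moreover have "weight (M + 2) t s \<le> exp (s * (t + s - (real M + 3)) / (t + s))"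
        using weight_le_exp[OF t that(1), of "M+2"] by (simp add: add.commute)
      ultimately have "weight (M + 2) t s \<le> exp (\<eta> M)"
        by (rule order_trans[rotated])
      then show ?thesis
        by simp
    qed
    then have "ratio M \<le> exp (\<eta> M) * gap M + 0 * (gap M)\<^sup>2 / 2"
      unfolding t_def by (rule ratio_le_quadratic)
    then show ?case
      by (simp add: field_simps)
  qed
  have upper: "eventually (\<lambda>M. gap M \<le> ratio M + 2 * \<bar>1 - q M\<bar>) sequentially"
    using le_2
  proof eventually_elim
    case (elim M)
    define X where "X = (1 - q M) * (gap M)\<^sup>2 / 2"
    have "gap M + X \<le> ratio M"
      using quadratic_le_ratio[of "gap M" M] gap_pos[of M] by (simp add: q_def X_def)
    moreover have "\<bar>1 - q M\<bar> * (gap M)\<^sup>2 \<le> \<bar>1 - q M\<bar> * 2\<^sup>2"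
      using elim gap_pos[of M] by (intro mult_left_mono power_mono) auto
    then have "\<bar>X\<bar> \<le> 2 * \<bar>1 - q M\<bar>"
      by (simp add: X_def abs_mult)
    ultimately show ?case by linarith
  qed
  have "\<eta> \<longlonglongrightarrow> 2 * (\<bar>1 - 1\<bar> + 2 * 0)"
    unfolding \<eta>_def by (intro tendsto_intros q inv)
  then have "(\<lambda>M. ratio M / exp (\<eta> M)) \<longlonglongrightarrow> 1 / exp 0"
    by (intro tendsto_intros ratio_tendsto_1) auto
  moreover have "(\<lambda>M. ratio M + 2 * \<bar>1 - q M\<bar>) \<longlonglongrightarrow> 1 + 2 * \<bar>1 - 1\<bar>"
    by (intro tendsto_intros ratio_tendsto_1 q)
  ultimately show ?thesis
    using tendsto_sandwich[OF lower upper] by simp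
qed

theorem theorem4p4:
  "(\<lambda>M. ln (alpha_L M) - ln (alpha_L (M + 1))) \<in> o(\<lambda>M. ln (alpha_L (M + 1))) \<and>
   alpha_L \<longlonglongrightarrow> exp 1"
proof
  have gap_Suc: "(\<lambda>M. gap (M + 1)) \<longlonglongrightarrow> 1"
    using LIMSEQ_ignore_initial_segment[OF gap_tendsto_1, of 1] .
  have "(\<lambda>M. (gap M - gap (M + 1)) / gap (M + 1)) \<longlonglongrightarrow> (1 - 1) / 1"
    by (intro tendsto_intros gap_tendsto_1 gap_Suc) simp
  then show "(\<lambda>M. ln (alpha_L M) - ln (alpha_L (M + 1))) \<in> o(\<lambda>M. ln (alpha_L (M + 1)))"
    unfolding alpha_L_eq_exp_gap ln_exp
    by (intro smalloI_tendsto) (use gap_pos in \<open>auto simp: less_imp_neq[symmetric]\<close>)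
  show "alpha_L \<longlonglongrightarrow> exp 1"
    unfolding alpha_L_eq_exp_gap[abs_def] by (intro tendsto_exp gap_tendsto_1)
qed

end
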